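(* For $\ell\geq1$, $0\leq c\leq p$ and $q,s\ge0$ (all integers), $$K_\ell((p,q),(c,s))=K_\ell((p-c,q),(0,s)).$$
   Context: $\mathbb N=\{0,1,2,\ldots\}$. A state is a pair $((p,q),L)$ with control $(p,q)\in\mathbb N^2$ and stack $L=(\ell_1,\ldots,\ell_r)$ a finite, possibly empty, list of positive integers. $\mathrm{nz}$ of a list deletes its zero entries. The transitions from $((p,q),L)$ are the following; differently indexed transitions are distinct even when their targets coincide. - Early-band moves: for each $0\le h<p$, target $((h,q+p-1-h),L)$. - Last-band moves: for each $0\le h<q$, target $((p,h),\mathrm{nz}(\ell_1+q-1-h,\ell_2,\ldots,\ell_r))$, where for an empty stack $\ell_1$ is read as $0$ and the tail as empty. - Active-head moves: if $L$ is nonempty, for each $a,b\ge0$ with $a+b=\ell_1-1$, target $((p,q),\mathrm{nz}(a,b,\ell_2,\ldots,\ell_r))$. For $\ell\ge1$ and a list $L$ of positive integers, a path (finite sequence of consecutive transitions) starting at the state with control $(p,q)$ and stack $(\ell)L$ (the concatenation) is stopped if it ends at a state whose stack is exactly $L$ and no earlier state on it has stack exactly $L$. $K_\ell((p,q),(c,s))$ is the number of stopped paths from $((p,q),(\ell)L)$ to $((c,s),L)$; this number does not depend on $L$. *)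

theory Defs
  imports Main
begin

type_synonym control = "nat \<times> nat"
type_synonym state = "control \<times> nat list"

definition nz :: "nat list \<Rightarrow> nat list" where
  "nz xs = filter (\<lambda>x. x \<noteq> 0) xs"

text \<open>The index of a transition. Transitions with different indices are distinct even if they
  share source and target, so paths record the index of every step.\<close>

datatype move = Early nat | Last nat | Head nat nat

inductive trans_step :: "state \<Rightarrow> move \<Rightarrow> state \<Rightarrow> bool" where
  early: "h < p \<Longrightarrow> trans_step ((p, q), L) (Early h) ((h, q + p - 1 - h), L)"
| last_empty: "h < q \<Longrightarrow> trans_step ((p, q), []) (Last h) ((p, h), nz [0 + q - 1 - h])"
| last_cons: "h < q \<Longrightarrow>
    trans_step ((p, q), x # xs) (Last h) ((p, h), nz ((x + q - 1 - h) # xs))"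
| head: "x \<ge> 1 \<Longrightarrow> a + b = x - 1 \<Longrightarrow>
    trans_step ((p, q), x # xs) (Head a b) ((p, q), nz (a # b # xs))"

text \<open>A path from a given state is the list of its transitions, each given by its index and its
  target.\<close>

inductive is_path :: "state \<Rightarrow> (move \<times> state) list \<Rightarrow> bool" where
  Nil: "is_path u []"
| Cons: "trans_step u m v \<Longrightarrow> is_path v w \<Longrightarrow> is_path u ((m, v) # w)"

definition visited :: "state \<Rightarrow> (move \<times> state) list \<Rightarrow> state list" where
  "visited u w = u # map snd w"

definition stopped :: "nat list \<Rightarrow> state \<Rightarrow> (move \<times> state) list \<Rightarrow> bool" where
  "stopped L u w \<longleftrightarrow> is_path u w \<and> snd (last (visited u w)) = L \<and>
     (\<forall>v \<in> set (butlast (visited u w)). snd v \<noteq> L)"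

definition stopped_paths ::
    "nat list \<Rightarrow> nat \<Rightarrow> control \<Rightarrow> control \<Rightarrow> (move \<times> state) list set" where
  "stopped_paths L l pq cs =
     {w. stopped L (pq, l # L) w \<and> last (visited (pq, l # L) w) = (cs, L)}"

text \<open>The count is independent of the bottom stack \<open>L\<close> (\<open>K_eq_card\<close> below), so it is
  defined with the empty one. The set counted is finite (\<open>finite_stopped_paths\<close>).\<close>

definition K :: "nat \<Rightarrow> control \<Rightarrow> control \<Rightarrow> nat" where
  "K l pq cs = card (stopped_paths [] l pq cs)"


definition mass :: "state \<Rightarrow> nat" where
  "mass u = fst (fst u) + snd (fst u) + sum_list (snd u)"

lemma sum_list_nz [simp]: "sum_list (nz xs) = sum_list xs"
  by (induction xs) (auto simp: nz_def)

lemma trans_step_mass: "trans_step u m v \<Longrightarrow> Suc (mass v) = mass u"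
  by (induction rule: trans_step.induct) (auto simp: mass_def)

lemma finite_trans_step: "finite {(m, v). trans_step u m v}"
proof -
  obtain p q L where u: "u = ((p, q), L)" by (metis surj_pair)
  let ?M = "Early ` {..<p} \<union> Last ` {..<q} \<union>
    (\<lambda>(a, b). Head a b) ` ({..hd L} \<times> {..hd L})"
  have det: "v = v'" if "trans_step u m v" "trans_step u m v'" for m v v'
    using that by (auto elim!: trans_step.cases)
  have "{(m, v). trans_step u m v} \<subseteq> (\<lambda>m. (m, THE v. trans_step u m v)) ` ?M"
  proof clarify
    fix m v assume t: "trans_step u m v"
    have "v = (THE v. trans_step u m v)"
      using det t by (metis (mono_tags, lifting) the_equality)
    moreover have "m \<in> ?M"
      using t unfolding u by (cases rule: trans_step.cases) auto
    ultimately show "(m, v) \<in> (\<lambda>m. (m, THE v. trans_step u m v)) ` ?M"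
      by blast
  qed
  then show ?thesis by (rule finite_subset) auto
qed

lemma finite_paths: "finite {w. is_path u w}"
proof (induction "mass u" arbitrary: u rule: less_induct)
  case less
  have "{w. is_path u w} \<subseteq> insert []
      (\<Union>(m, v) \<in> {(m, v). trans_step u m v}. (\<lambda>w. (m, v) # w) ` {w. is_path v w})"
    by (auto elim!: is_path.cases[of u])
  moreover have "finite {w. is_path v w}" if "trans_step u m v" for m v
    using less[of v] trans_step_mass[OF that] by simp
  ultimately show ?case
    using finite_trans_step[of u]
    by (elim finite_subset) (auto intro!: finite_UN_I)
qed

lemma finite_stopped_paths: "finite (stopped_paths L l pq cs)"
  by (rule finite_subset[OF _ finite_paths]) (auto simp: stopped_paths_def stopped_def)

text \<open>Placing the stack \<open>L\<close> below all stacks of a path.\<close>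

definition lift_state :: "nat list \<Rightarrow> state \<Rightarrow> state" where
  "lift_state L u = (fst u, snd u @ L)"

definition lift_path :: "nat list \<Rightarrow> (move \<times> state) list \<Rightarrow> (move \<times> state) list" where
  "lift_path L = map (\<lambda>(m, v). (m, lift_state L v))"

lemma nz_append [simp]: "nz (xs @ ys) = nz xs @ nz ys"
  by (simp add: nz_def)

lemma nz_id: "0 \<notin> set L \<Longrightarrow> nz L = L"
  by (induction L) (auto simp: nz_def)

lemma trans_step_lift:
  assumes "0 \<notin> set L" "snd u \<noteq> []"
  shows "trans_step (lift_state L u) m v' \<longleftrightarrow>
    (\<exists>v. trans_step u m v \<and> v' = lift_state L v)"
proof -
  obtain p q x xs where u: "u = ((p, q), x # xs)"
    using assms(2) by (metis list.exhaust prod.collapse)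
  have nzL: "nz (y # xs @ L) = nz (y # xs) @ L" "nz (y # z # xs @ L) = nz (y # z # xs) @ L" for y z
    using nz_append[of "y # xs" L] nz_append[of "y # z # xs" L] nz_id[OF assms(1)] by auto
  show ?thesis
    unfolding u lift_state_def
    by (cases m) (auto simp: nzL trans_step.simps)
qed

lemma stopped_Nil: "stopped L u [] \<longleftrightarrow> snd u = L"
  by (auto simp: stopped_def visited_def intro: is_path.intros)

lemma stopped_Cons:
  "stopped L u ((m, v) # w) \<longleftrightarrow> snd u \<noteq> L \<and> trans_step u m v \<and> stopped L v w"
  by (auto simp: stopped_def visited_def intro: is_path.intros elim: is_path.cases)

lemma stopped_lift:
  assumes "0 \<notin> set L"
  shows "stopped L (lift_state L u) w' \<longleftrightarrow> (\<exists>w. stopped [] u w \<and> w' = lift_path L w)"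
proof (induction w' arbitrary: u)
  case Nil
  show ?case
    by (auto simp: stopped_Nil lift_state_def lift_path_def)
next
  case (Cons mv w')
  obtain m v' where mv: "mv = (m, v')" by (cases mv)
  show ?case
  proof (cases "snd u = []")
    case True
    have "w = []" if "stopped [] u w" for w
      using that True by (cases w) (auto simp: stopped_Cons)
    then show ?thesis
      using True by (auto simp: mv stopped_Cons lift_state_def lift_path_def)
  next
    case False
    have "stopped L (lift_state L u) (mv # w') \<longleftrightarrow>
        trans_step (lift_state L u) m v' \<and> stopped L v' w'"
      using False by (simp add: mv stopped_Cons lift_state_def)
    also have "\<dots> \<longleftrightarrow> (\<exists>v w. trans_step u m v \<and> v' = lift_state L v \<and>
        stopped [] v w \<and> w' = lift_path L w)"
      unfolding trans_step_lift[OF assms False] using Cons.IH by blast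
    also have "\<dots> \<longleftrightarrow> (\<exists>w. stopped [] u w \<and> mv # w' = lift_path L w)"
    proof
      assume "\<exists>v w. trans_step u m v \<and> v' = lift_state L v \<and> stopped [] v w \<and> w' = lift_path L w"
      then obtain v w where "trans_step u m v" "v' = lift_state L v" "stopped [] v w"
        "w' = lift_path L w" by blast
      then have "stopped [] u ((m, v) # w) \<and> mv # w' = lift_path L ((m, v) # w)"
        using False by (simp add: stopped_Cons mv lift_path_def)
      then show "\<exists>w. stopped [] u w \<and> mv # w' = lift_path L w" by blast
    next
      assume "\<exists>w. stopped [] u w \<and> mv # w' = lift_path L w"
      then show "\<exists>v w. trans_step u m v \<and> v' = lift_state L v \<and> stopped [] v w \<and> w' = lift_path L w"
        by (fastforce simp: lift_path_def mv stopped_Cons)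
    qed
    finally show ?thesis .
  qed
qed

lemma visited_lift: "visited (lift_state L u) (lift_path L w) = map (lift_state L) (visited u w)"
  by (auto simp: visited_def lift_path_def)

lemma inj_lift_path: "inj (lift_path L)"
  unfolding lift_path_def
  by (rule inj_mapI) (auto simp: inj_def lift_state_def prod_eq_iff)

theorem K_eq_card:
  assumes "0 \<notin> set L"
  shows "K l pq cs = card (stopped_paths L l pq cs)"
proof -
  have u: "(pq, l # L) = lift_state L (pq, [l])"
    by (simp add: lift_state_def)
  have "stopped_paths L l pq cs = lift_path L ` stopped_paths [] l pq cs"
  proof -
    have *: "last (visited (lift_state L (pq, [l])) (lift_path L w)) = (cs, L) \<longleftrightarrow>
        last (visited (pq, [l]) w) = (cs, [])" for w
    proof -
      have "visited (pq, [l]) w \<noteq> []" by (simp add: visited_def)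
      then show ?thesis
        by (simp add: visited_lift last_map) (auto simp: lift_state_def prod_eq_iff)
    qed
    show ?thesis
      unfolding stopped_paths_def u stopped_lift[OF assms]
      using * by auto
  qed
  then show ?thesis
    by (simp add: K_def card_image[OF inj_on_subset[OF inj_lift_path]])
qed

end

theory Submission
  imports Defs
begin

text \<open>The first control coordinate never increases along a path, so a path that ends with first
  coordinate \<open>c\<close> keeps it at least \<open>c\<close> throughout. On such states the first coordinate
  may be lowered by \<open>c\<close>: an early-band move has target \<open>(h, q + (p - 1 - h))\<close>, whose second
  entry depends on \<open>p\<close> and \<open>h\<close> through their difference only, and the last-band and
  active-head moves do not look at \<open>p\<close>. Stacks are unchanged, so being stopped is too. Hence
  raising the first coordinate by \<open>c\<close> along the whole path is a bijection from the paths counted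
  on the right onto those counted on the left (\<open>stopped_paths_shift\<close>).\<close>

definition shift_state :: "nat \<Rightarrow> state \<Rightarrow> state" where
  "shift_state d u = ((fst (fst u) + d, snd (fst u)), snd u)"

fun shift_move :: "nat \<Rightarrow> move \<Rightarrow> move" where
  "shift_move d (Early h) = Early (h + d)"
| "shift_move d (Last h) = Last h"
| "shift_move d (Head a b) = Head a b"

definition shift_path :: "nat \<Rightarrow> (move \<times> state) list \<Rightarrow> (move \<times> state) list" where
  "shift_path d = map (map_prod (shift_move d) (shift_state d))"

lemma shift_path_simps [simp]:
  "shift_path d [] = []"
  "shift_path d ((m, v) # w) = (shift_move d m, shift_state d v) # shift_path d w"
  by (simp_all add: shift_path_def)

lemma snd_shift_state [simp]: "snd (shift_state d u) = snd u"
  by (simp add: shift_state_def)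

lemma inj_shift_path: "inj (shift_path d)"
proof -
  have "inj (shift_move d)"
  proof (rule injI)
    fix m n assume "shift_move d m = shift_move d n"
    then show "m = n" by (cases m; cases n) auto
  qed
  moreover have "inj (shift_state d)"
    by (auto simp: inj_def shift_state_def)
  ultimately show ?thesis
    unfolding shift_path_def by (intro inj_mapI prod.inj_map)
qed

lemma shift_stateE:
  assumes "d \<le> fst (fst v)"
  obtains u where "v = shift_state d u"
proof -
  have "v = shift_state d ((fst (fst v) - d, snd (fst v)), snd v)"
    using assms by (simp add: shift_state_def prod_eq_iff)
  then show ?thesis by (rule that)
qed

lemma trans_step_antimono: "trans_step u m v \<Longrightarrow> fst (fst v) \<le> fst (fst u)"
  by (induction rule: trans_step.induct) auto

lemma is_path_antimono: "is_path u w \<Longrightarrow> fst (fst (last (visited u w))) \<le> fst (fst u)"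
proof (induction rule: is_path.induct)
  case (Nil u)
  then show ?case by (simp add: visited_def)
next
  case (Cons u m v w)
  then show ?case using trans_step_antimono[OF Cons(1)] by (simp add: visited_def)
qed

text \<open>Besides the invariance of the moves, this says that an index leading from one raised state to
  another is itself raised: an early-band index is the first coordinate of its target.\<close>

lemma trans_step_shift:
  "trans_step (shift_state d u) m (shift_state d v) \<longleftrightarrow>
    (\<exists>n. m = shift_move d n \<and> trans_step u n v)" (is "?L \<longleftrightarrow> ?R")
proof -
  obtain p q S where u: "u = ((p, q), S)" by (metis surj_pair)
  obtain p' q' S' where v: "v = ((p', q'), S')" by (metis surj_pair)
  show ?thesis
  proof
    assume t: ?L
    have "trans_step u (case m of Early h \<Rightarrow> Early (h - d) | _ \<Rightarrow> m) v"
        "m = shift_move d (case m of Early h \<Rightarrow> Early (h - d) | _ \<Rightarrow> m)"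
      using t unfolding u v shift_state_def
      by (cases m; auto simp: trans_step.simps)+
    then show ?R by blast
  next
    assume ?R
    then obtain n where n: "m = shift_move d n" "trans_step u n v" by blast
    from n(2) show ?L
      unfolding n(1) u v shift_state_def
      by (cases rule: trans_step.cases) (auto simp: trans_step.simps)
  qed
qed

text \<open>The endpoint is prescribed because, by monotonicity, it forces every state on the path to
  be raised; a path from a raised state alone may drop below \<open>d\<close> by an early-band move.\<close>

lemma stopped_shift:
  "stopped L (shift_state d u) w' \<and> last (visited (shift_state d u) w') = shift_state d e \<longleftrightarrow>
    (\<exists>w. w' = shift_path d w \<and> stopped L u w \<and> last (visited u w) = e)"
proof (induction w' arbitrary: u)
  case Nil
  have "shift_state d u = shift_state d e \<longleftrightarrow> u = e"
    by (auto simp: shift_state_def prod_eq_iff)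
  then show ?case
    by (auto simp: stopped_Nil visited_def shift_path_def)
next
  case (Cons mv w')
  obtain m v' where mv: "mv = (m, v')" by (cases mv)
  have vis: "last (visited x ((k, y) # w)) = last (visited y w)" for x k y w
    by (simp add: visited_def)
  show ?case (is "?L \<longleftrightarrow> ?R")
  proof
    assume ?L
    then have step: "snd u \<noteq> L" "trans_step (shift_state d u) m v'"
      and rest: "stopped L v' w'" "last (visited v' w') = shift_state d e"
      by (simp_all add: mv stopped_Cons vis)
    have "fst (fst (shift_state d e)) \<le> fst (fst v')"
      using is_path_antimono[of v' w'] rest by (simp add: stopped_def)
    then have "d \<le> fst (fst v')" by (simp add: shift_state_def)
    then obtain v where v: "v' = shift_state d v" by (rule shift_stateE)
    obtain n where "m = shift_move d n" "trans_step u n v"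
      using step(2) unfolding v trans_step_shift by blast
    moreover obtain w where "w' = shift_path d w" "stopped L v w" "last (visited v w) = e"
      using rest Cons.IH[of v] unfolding v by blast
    ultimately have "mv # w' = shift_path d ((n, v) # w) \<and> stopped L u ((n, v) # w) \<and>
        last (visited u ((n, v) # w)) = e"
      using step(1) by (simp add: mv v stopped_Cons vis)
    then show ?R by blast
  next
    assume ?R
    then obtain n v w where w: "mv # w' = shift_path d ((n, v) # w)"
        "stopped L u ((n, v) # w)" "last (visited u ((n, v) # w)) = e"
      by (metis list.exhaust list.distinct(1) shift_path_simps(1) surj_pair)
    then have "stopped L (shift_state d v) w'"
        "last (visited (shift_state d v) w') = shift_state d e"
      using Cons.IH[of v] by (auto simp: stopped_Cons vis)
    moreover have "trans_step (shift_state d u) m (shift_state d v)"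
      using w trans_step_shift by (auto simp: mv stopped_Cons)
    ultimately show ?L
      using w by (auto simp: mv stopped_Cons vis)
  qed
qed

lemma stopped_paths_shift:
  "stopped_paths L l (p + d, q) (c + d, s) = shift_path d ` stopped_paths L l (p, q) (c, s)"
proof -
  have "((p + d, q), l # L) = shift_state d ((p, q), l # L)"
    "((c + d, s), L) = shift_state d ((c, s), L)"
    by (simp_all add: shift_state_def)
  then show ?thesis
    unfolding stopped_paths_def by (auto simp: stopped_shift)
qed

theorem lemma7p2:
  fixes l p q c s :: nat
  assumes "l \<ge> 1" and "c \<le> p"
  shows "K l (p, q) (c, s) = K l (p - c, q) (0, s)"
proof -
  have "stopped_paths [] l (p, q) (c, s) = shift_path c ` stopped_paths [] l (p - c, q) (0, s)"
    using stopped_paths_shift[of "[]" l "p - c" c q 0 s] assms(2) by simp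
  then show ?thesis
    by (simp add: K_def card_image[OF inj_on_subset[OF inj_shift_path]])
qed

end
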